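(* Let $m\ge 1$, let $\mathbf u=(u_1,\dots,u_m)$ be a vector of positive integers with $u_1<\cdots<u_m$, and let $1\le l\le m$ be an integer. Let $\mathbf v=(v_1,\dots,v_l)$ be in increasing order with $v_i=u_{k_i}$ for all $1\le i\le l$, where $1\le k_1<\cdots<k_l\le m$. Let $\pi_{l+1},\dots,\pi_m$ be positive integers. Then $A_{\pi_{l+1},\dots,\pi_m}=[\mathbf v]$ if and only if $(\pi_{l+1},\dots,\pi_m)\in\mathrm{MS}(\mathbf v)$.
   Context: For a strictly increasing vector $(t_1,\dots,t_n)$ of positive integers, $\mathrm{PF}(t_1,\dots,t_n)$ is the set of sequences of $n$ positive integers whose non-decreasing rearrangement $(\lambda_1,\dots,\lambda_n)$ satisfies $\lambda_i\le t_i$ for all $i$; for $n=0$ it consists of the empty word only. For fixed $\pi_{l+1},\dots,\pi_m$, let $$A_{\pi_{l+1},\dots,\pi_m}=\{\mathbf w=(w_1,\dots,w_l): w_1\le\cdots\le w_l,\ (w_1,\dots,w_l,\pi_{l+1},\dots,\pi_m)\in\mathrm{PF}(\mathbf u)\},$$ and let $[\mathbf v]$ be the set of non-decreasing vectors $\mathbf w=(w_1,\dots,w_l)$ of positive integers with $w_i\le v_i$ for all $1\le i\le l$. Multi-shuffle: for $\mathbf v=(u_{k_1},\dots,u_{k_l})$ with $1\le k_1<\cdots<k_l\le m$, we say $(\pi_{l+1},\dots,\pi_m)\in\mathrm{MS}(\mathbf v)$ if there exist words $\alpha_1\in\mathrm{PF}(u_1,\dots,u_{k_1-1})$, $\alpha_j\in\mathrm{PF}(u_{k_{j-1}+1}-u_{k_{j-1}},\dots,u_{k_j-1}-u_{k_{j-1}})$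 for $2\le j\le l$, and $\alpha_{l+1}\in\mathrm{PF}(u_{k_l+1}-u_{k_l},\dots,u_m-u_{k_l})$ such that $(\pi_{l+1},\dots,\pi_m)$ is a permutation of the union (concatenation, as a multiset) of the $l+1$ words $\alpha_1,\ \alpha_2+(u_{k_1},\dots,u_{k_1}),\ \dots,\ \alpha_{l+1}+(u_{k_l},\dots,u_{k_l})$. A word $\alpha_j$ whose index range is empty (e.g. $k_{j-1}=k_j-1$) is the empty word. *)

theory Defs
  imports Main "HOL-Library.Multiset"
begin

text \<open>Vectors and words are lists of naturals; positivity of the entries is always required
  explicitly.\<close>

definition PF :: "nat list \<Rightarrow> nat list set" where
  "PF t = {w. length w = length t \<and> (\<forall>x\<in>set w. 0 < x) \<and> (\<forall>i<length t. sort w ! i \<le> t ! i)}"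

text \<open>\<open>A_set u l p\<close> is the set $A_{\pi_{l+1},\dots,\pi_m}$ for
  $p = (\pi_{l+1},\dots,\pi_m)$.\<close>

definition A_set :: "nat list \<Rightarrow> nat \<Rightarrow> nat list \<Rightarrow> nat list set" where
  "A_set u l p = {w. length w = l \<and> sorted w \<and> w @ p \<in> PF u}"

text \<open>The set $[\mathbf v]$.\<close>

definition lower_box :: "nat list \<Rightarrow> nat list set" where
  "lower_box v = {w. length w = length v \<and> sorted w \<and> (\<forall>x\<in>set w. 0 < x) \<and>
     (\<forall>i<length v. w ! i \<le> v ! i)}"

text \<open>Coordinates \<open>coord u i\<close> $= u_i$ are numbered from 1, and the indices
  $k_1 < \cdots < k_l$ stored in the list \<open>k\<close> refer to this numbering. The conventions
  $u_0 = 0$, $k_0 = 0$ and $k_{l+1} = m+1$ make the first and the last word of a multi-shuffle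
  instances of the general case.\<close>

definition coord :: "nat list \<Rightarrow> nat \<Rightarrow> nat" where
  "coord u i = (if i = 0 then 0 else u ! (i - 1))"

definition cut :: "nat list \<Rightarrow> nat list \<Rightarrow> nat \<Rightarrow> nat" where
  "cut u k j = (if j = 0 then 0 else if j \<le> length k then k ! (j - 1) else length u + 1)"

text \<open>For $1 \le j \le l+1$, \<open>block u k j\<close> is
  $(u_{k_{j-1}+1}-u_{k_{j-1}},\dots,u_{k_j-1}-u_{k_{j-1}})$, which is empty if
  $k_{j-1} = k_j - 1$. The subtraction does not truncate when \<open>u\<close> is increasing.\<close>

definition block :: "nat list \<Rightarrow> nat list \<Rightarrow> nat \<Rightarrow> nat list" where
  "block u k j =
     map (\<lambda>i. coord u i - coord u (cut u k (j - 1))) [cut u k (j - 1) + 1 ..< cut u k j]"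

text \<open>\<open>MS u k\<close> is $\mathrm{MS}(\mathbf v)$ for $\mathbf v = (u_{k_1},\dots,u_{k_l})$; as \<open>u\<close> is
  strictly increasing, $\mathbf v$ and \<open>k\<close> determine each other. The word $\alpha_j$ is
  \<open>\<alpha> j\<close> for $1 \le j \le l+1$; other values of \<open>\<alpha>\<close> are irrelevant.\<close>

definition MS :: "nat list \<Rightarrow> nat list \<Rightarrow> nat list set" where
  "MS u k = {p. \<exists>\<alpha> :: nat \<Rightarrow> nat list.
     (\<forall>j\<in>{1..length k + 1}. \<alpha> j \<in> PF (block u k j)) \<and>
     mset p = (\<Sum>j\<in>{1..length k + 1}. mset (map (\<lambda>x. x + coord u (cut u k (j - 1))) (\<alpha> j)))}"

end

theory Submission
  imports Defs
begin

text \<open>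
  Membership in \<open>PF t\<close> only depends on the counting function of a word: the word has to contain
  at least \<open>i\<close> entries that are at most the \<open>i\<close>-th coordinate of \<open>t\<close>, for every \<open>i\<close>
  (lemma \<open>PF_iff_count_le\<close>). Write $N(c)$ for the number of entries of $p$ that are at most $c$
  and put $k_0 = 0$, $k_{l+1} = m+1$. Both sides of the equivalence say that, for all
  $0 \le j \le l$,
  \[ N(u_{k_j}) = k_j - j \qquad\mbox{and}\qquad
     N(u_i) \ge i - j \quad\mbox{whenever } k_j \le i < k_{j+1}. \]
  This is the predicate \<open>balanced\<close> below.

  For $A = [\mathbf v]$: exactly $j$ entries of $\mathbf v$ are at most $u_i$ when
  $k_j \le i < k_{j+1}$, so the inequalities say that $\mathbf v \in A$, which amounts to
  $[\mathbf v] \subseteq A$ since lowering entries preserves membership. If $w_j > v_j$, then at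
  most $j - 1$ entries of $\mathbf w$ are at most $u_{k_j}$, and $N(u_{k_j}) = k_j - j$ leaves
  $\mathbf w$ followed by $p$ at least one entry short there. If the inequalities hold, but
  $N(u_{k_j}) > k_j - j$ for some $j \ge 1$, then the word of $j - 1$ ones followed by $l - j + 1$
  entries $v_j + 1$ lies in $A$, but not in $[\mathbf v]$.

  For $p \in \mathrm{MS}(\mathbf v)$: the shifted word coming from $\alpha_j$ is recovered from
  $p$ as the subword of the entries in $(u_{k_{j-1}}, u_{k_j}]$ (without upper bound if
  $j = l + 1$). The equalities say that these subwords have the right lengths, and given that,
  the inequalities say that they are parking functions for the blocks.
\<close>

section \<open>Parking functions by counting\<close>

definition count_le :: "nat \<Rightarrow> nat list \<Rightarrow> nat" where
  "count_le c xs = length (filter (\<lambda>x. x \<le> c) xs)"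

lemma count_le_append: "count_le c (xs @ ys) = count_le c xs + count_le c ys"
  by (simp add: count_le_def)

lemma count_le_mset: "count_le c xs = size (filter_mset (\<lambda>x. x \<le> c) (mset xs))"
  by (simp add: count_le_def flip: mset_filter)

lemma count_le_le_length: "count_le c xs \<le> length xs"
  by (simp add: count_le_def)

lemma count_le_eq_length: "(\<And>x. x \<in> set xs \<Longrightarrow> x \<le> c) \<Longrightarrow> count_le c xs = length xs"
  by (simp add: count_le_def)

lemma count_le_mono: "c \<le> d \<Longrightarrow> count_le c xs \<le> count_le d xs"
  by (induction xs) (auto simp: count_le_def)

lemma count_le_0_of_pos: "\<forall>x\<in>set xs. 0 < x \<Longrightarrow> count_le 0 xs = 0"
  by (auto simp: count_le_def filter_empty_conv)

text \<open>In a sorted list the entries that are at most \<open>c\<close> form a prefix.\<close>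

lemma sorted_nth_le_iff_count_le:
  assumes "sorted xs" "i < length xs"
  shows "xs ! i \<le> c \<longleftrightarrow> i < count_le c xs"
proof -
  have "xs ! i \<le> c \<longleftrightarrow> i < length (takeWhile (\<lambda>x. x \<le> c) xs)"
  proof
    assume *: "xs ! i \<le> c"
    show "i < length (takeWhile (\<lambda>x. x \<le> c) xs)"
    proof (rule ccontr)
      assume n: "\<not> ?thesis"
      let ?n = "length (takeWhile (\<lambda>x. x \<le> c) xs)"
      have "?n < length xs" using n assms(2) by linarith
      hence "\<not> xs ! ?n \<le> c" by (rule nth_length_takeWhile)
      moreover have "xs ! ?n \<le> xs ! i" using n assms by (auto intro: sorted_nth_mono)
      ultimately show False using * by linarith
    qed
  next
    assume *: "i < length (takeWhile (\<lambda>x. x \<le> c) xs)"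
    show "xs ! i \<le> c" using nth_mem[OF *] takeWhile_nth[OF *] set_takeWhileD by metis
  qed
  also have "takeWhile (\<lambda>x. x \<le> c) xs = filter (\<lambda>x. x \<le> c) xs"
    using assms(1) by (induction xs) (auto simp: empty_filter_conv)
  finally show ?thesis by (simp add: count_le_def)
qed

lemma PF_iff_count_le:
  "w \<in> PF t \<longleftrightarrow> length w = length t \<and> (\<forall>x\<in>set w. 0 < x) \<and>
     (\<forall>i<length t. i < count_le (t ! i) w)"
proof -
  have "count_le c (sort w) = count_le c w" for c
    by (simp add: count_le_mset)
  hence *: "sort w ! i \<le> c \<longleftrightarrow> i < count_le c w" if "i < length w" for i c
    using sorted_nth_le_iff_count_le[of "sort w" i c] that by simp
  have "(\<forall>i<length t. sort w ! i \<le> t ! i) \<longleftrightarrow> (\<forall>i<length t. i < count_le (t ! i) w)"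
    if "length w = length t"
    using that by (intro all_cong1 imp_cong refl *) simp
  thus ?thesis unfolding PF_def by blast
qed

section \<open>A vector with marked coordinates\<close>

locale marked_vector =
  fixes u k :: "nat list"
  assumes pos_u: "\<forall>x\<in>set u. 0 < x" and incr_u: "sorted_wrt (<) u"
    and k_range: "set k \<subseteq> {1..length u}" and incr_k: "sorted_wrt (<) k"
begin

abbreviation "m \<equiv> length u"
abbreviation "l \<equiv> length k"
abbreviation "U \<equiv> coord u"
abbreviation "K \<equiv> cut u k"

lemma U_0: "U 0 = 0" by (simp add: coord_def)

lemma K_0: "K 0 = 0" by (simp add: cut_def)

lemma K_last: "K (Suc l) = Suc m" by (simp add: cut_def)

lemma U_less: "i < j \<Longrightarrow> j \<le> m \<Longrightarrow> U i < U j"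
  using pos_u sorted_wrt_nth_less[OF incr_u, of "i - 1" "j - 1"] by (auto simp: coord_def)

lemma U_mono: "i \<le> j \<Longrightarrow> j \<le> m \<Longrightarrow> U i \<le> U j"
  using U_less[of i j] by (cases "i = j") auto

lemma K_le: "j \<le> l \<Longrightarrow> K j \<le> m"
  using k_range nth_mem[of "j - 1" k] by (cases "j = 0") (fastforce simp: cut_def subset_eq)+

lemma K_less: "i < j \<Longrightarrow> j \<le> Suc l \<Longrightarrow> K i < K j"
proof (cases "i = 0 \<or> j = Suc l")
  case True
  moreover assume ij: "i < j" "j \<le> Suc l"
  ultimately show ?thesis
    using K_le[of i] k_range nth_mem[of "j - 1" k]
    by (cases "j = Suc l") (fastforce simp: cut_def subset_eq)+
next
  case False
  moreover assume "i < j" "j \<le> Suc l"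
  ultimately show ?thesis
    using sorted_wrt_nth_less[OF incr_k, of "i - 1" "j - 1"] by (auto simp: cut_def)
qed

lemma K_mono: "i \<le> j \<Longrightarrow> j \<le> Suc l \<Longrightarrow> K i \<le> K j"
  using K_less[of i j] by (cases "i = j") auto

text \<open>The cuts \<open>0 = K 0 < K 1 < \<dots> < K (Suc l) = Suc m\<close> divide \<open>{0..m}\<close> into segments, each of
  which begins with a marked index or with \<open>0\<close>.\<close>

lemma ex_segment:
  assumes "i \<le> m"
  obtains j where "j \<le> l" "K j \<le> i" "i < K (Suc j)"
proof -
  have "\<exists>j<Suc l. (\<forall>a\<le>j. \<not> i < K a) \<and> i < K (Suc j)"
    by (rule ex_least_nat_less) (use assms K_0 K_last in auto)
  thus ?thesis using that by (auto simp: less_Suc_eq_le not_less)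
qed

lemma length_block: "length (block u k j) = K j - Suc (K (j - 1))"
  by (simp add: block_def)

lemma nth_block:
  assumes "i < length (block u k j)"
  shows "block u k j ! i = U (Suc (K (j - 1) + i)) - U (K (j - 1))"
  using assms by (simp add: block_def)

text \<open>Allowing the trivial index \<open>i = 0\<close>, whose coordinate is \<open>0\<close> by convention, lets the
  segment that starts at the cut \<open>K 0 = 0\<close> be treated like all others.\<close>

lemma PF_iff_count_le_coord:
  "w \<in> PF u \<longleftrightarrow> length w = m \<and> (\<forall>x\<in>set w. 0 < x) \<and> (\<forall>i\<le>m. i \<le> count_le (U i) w)"
proof -
  have "(\<forall>i<m. i < count_le (u ! i) w) \<longleftrightarrow> (\<forall>i\<le>m. i \<le> count_le (U i) w)"
  proof safe
    fix i assume *: "\<forall>i<m. i < count_le (u ! i) w" "i \<le> m"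
    show "i \<le> count_le (U i) w"
      using *(1)[rule_format, of "i - 1"] *(2) by (cases i) (auto simp: coord_def)
  next
    fix i assume *: "\<forall>i\<le>m. i \<le> count_le (U i) w" "i < m"
    show "i < count_le (u ! i) w"
      using *(1)[rule_format, of "Suc i"] *(2) by (auto simp: coord_def)
  qed
  thus ?thesis by (auto simp: PF_iff_count_le)
qed

text \<open>The common reformulation of both sides of the theorem. The subtractions are moved to the
  other side so that no truncation occurs; the case \<open>j = 0\<close> of the equality only says that \<open>p\<close>
  has no entry \<open>0\<close>.\<close>

definition balanced :: "nat list \<Rightarrow> bool" where
  "balanced p \<longleftrightarrow> (\<forall>j\<le>l. count_le (U (K j)) p + j = K j \<and>
     (\<forall>i. K j \<le> i \<and> i < K (Suc j) \<longrightarrow> i \<le> count_le (U i) p + j))"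

lemma balancedD_eq: "balanced p \<Longrightarrow> j \<le> l \<Longrightarrow> count_le (U (K j)) p + j = K j"
  and balancedD_ge: "balanced p \<Longrightarrow> j \<le> l \<Longrightarrow> K j \<le> i \<Longrightarrow> i < K (Suc j) \<Longrightarrow>
    i \<le> count_le (U i) p + j"
  by (auto simp: balanced_def)

section \<open>The fibre is a box\<close>

lemma A_set_iff:
  assumes "l + length p = m" and "\<forall>x\<in>set p. 0 < x"
  shows "w \<in> A_set u l p \<longleftrightarrow> length w = l \<and> sorted w \<and> (\<forall>x\<in>set w. 0 < x) \<and>
    (\<forall>i\<le>m. i \<le> count_le (U i) w + count_le (U i) p)"
  using assms by (auto simp: A_set_def PF_iff_count_le_coord count_le_append)

lemma lower_box_iff:
  assumes "length v = l" and "\<And>j. j < l \<Longrightarrow> v ! j = U (K (Suc j))"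
  shows "w \<in> lower_box v \<longleftrightarrow> length w = l \<and> sorted w \<and> (\<forall>x\<in>set w. 0 < x) \<and>
    (\<forall>j<l. w ! j \<le> U (K (Suc j)))"
  using assms by (auto simp: lower_box_def)

text \<open>For \<open>A \<subseteq> [v]\<close> only the marked coordinates matter: the equality there forces \<open>w\<close> to supply
  the \<open>j\<close> entries that \<open>p\<close> lacks. For \<open>[v] \<subseteq> A\<close> only the inequalities matter: a word below \<open>v\<close>
  supplies \<open>j\<close> entries throughout segment \<open>j\<close>.\<close>

lemma balanced_imp_A_set_eq:
  assumes p: "l + length p = m" "\<forall>x\<in>set p. 0 < x"
    and v: "length v = l" "\<And>j. j < l \<Longrightarrow> v ! j = U (K (Suc j))"
    and bal: "balanced p"
  shows "A_set u l p = lower_box v"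
proof (intro set_eqI iffI)
  fix w assume w: "w \<in> A_set u l p"
  show "w \<in> lower_box v"
  proof -
    have "w ! j \<le> U (K (Suc j))" if "j < l" for j
    proof -
      have "K (Suc j) \<le> count_le (U (K (Suc j))) w + count_le (U (K (Suc j))) p"
        using w K_le[of "Suc j"] that by (auto simp: A_set_iff[OF p])
      hence "j < count_le (U (K (Suc j))) w" using balancedD_eq[OF bal, of "Suc j"] that by simp
      thus ?thesis using sorted_nth_le_iff_count_le[of w j] w that by (auto simp: A_set_iff[OF p])
    qed
    thus ?thesis using w by (auto simp: A_set_iff[OF p] lower_box_iff[OF v])
  qed
next
  fix w assume "w \<in> lower_box v"
  hence w: "length w = l" "sorted w" "\<forall>x\<in>set w. 0 < x" "\<And>j. j < l \<Longrightarrow> w ! j \<le> U (K (Suc j))"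
    by (auto simp: lower_box_iff[OF v])
  have "i \<le> count_le (U i) w + count_le (U i) p" if i: "i \<le> m" for i
  proof -
    obtain j where j: "j \<le> l" "K j \<le> i" "i < K (Suc j)" using ex_segment[OF i] by blast
    have "j \<le> count_le (U i) w"
    proof (cases j)
      case (Suc j')
      have "w ! j' \<le> U i" using w(4)[of j'] U_mono[OF j(2) i] j(1) Suc by auto
      thus ?thesis using sorted_nth_le_iff_count_le[OF w(2), of j' "U i"] w(1) j(1) Suc by auto
    qed simp
    thus ?thesis using balancedD_ge[OF bal j] by simp
  qed
  thus "w \<in> A_set u l p" using w by (auto simp: A_set_iff[OF p])
qed

text \<open>The inequalities are read off from the largest word \<open>v\<close> of the box. The equalities follow
  because a surplus at a marked coordinate would put a word outside the box into \<open>A\<close>.\<close>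

lemma A_set_eq_imp_balanced:
  assumes p: "l + length p = m" "\<forall>x\<in>set p. 0 < x"
    and v: "length v = l" "\<And>j. j < l \<Longrightarrow> v ! j = U (K (Suc j))"
    and eq: "A_set u l p = lower_box v"
  shows "balanced p"
proof -
  have UK_pos: "0 < U (K (Suc j))" if "j < l" for j
    using U_less[of 0 "K (Suc j)"] K_less[of 0 "Suc j"] K_le[of "Suc j"] that by (simp add: U_0 K_0)
  have v_sorted: "sorted v"
    using v by (auto simp: sorted_iff_nth_mono intro!: U_mono K_mono K_le)
  have "v \<in> lower_box v"
    using v UK_pos v_sorted by (auto simp: lower_box_def in_set_conv_nth)
  hence vA: "\<And>i. i \<le> m \<Longrightarrow> i \<le> count_le (U i) v + count_le (U i) p"
    by (auto simp: A_set_iff[OF p] simp flip: eq)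
  have ge: "i \<le> count_le (U i) p + j" if j: "j \<le> l" "K j \<le> i" "i < K (Suc j)" for i j
  proof -
    have im: "i \<le> m" using j K_mono[of "Suc j" "Suc l"] K_last by auto
    have "count_le (U i) v \<le> j"
    proof (cases "j = l")
      case True
      thus ?thesis using count_le_le_length[of "U i" v] v by simp
    next
      case False
      hence "U i < v ! j" using j v U_less[of i "K (Suc j)"] K_le[of "Suc j"] by auto
      thus ?thesis using sorted_nth_le_iff_count_le[OF v_sorted, of j "U i"] v j False by auto
    qed
    thus ?thesis using vA[OF im] by simp
  qed
  have le: "count_le (U (K (Suc j))) p + Suc j \<le> K (Suc j)" if j: "j < l" for j
  proof (rule ccontr)
    assume surplus: "\<not> ?thesis"
    let ?c = "U (K (Suc j))"
    \<comment> \<open>Among the positive sorted words whose entry at position \<open>j\<close> exceeds the bound \<open>?c\<close>, this one is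
      pointwise smallest, hence the one that lies in \<open>A\<close> if any of them does. It loses against \<open>v\<close>
      only at the coordinate \<open>?c\<close> itself, where the surplus of \<open>p\<close> makes up for it.\<close>
    let ?w = "replicate j 1 @ replicate (l - j) (Suc ?c)"
    have "i \<le> count_le (U i) ?w + count_le (U i) p" if i: "i \<le> m" for i
    proof (cases "i = 0")
      case False
      obtain n where n: "n \<le> l" "K n \<le> i" "i < K (Suc n)" using ex_segment[OF i] by blast
      have one: "1 \<le> U i" using U_less[of 0 i] i False by simp
      have low: "j \<le> count_le (U i) ?w" using one by (simp add: count_le_def)
      consider "i < K (Suc j)" | "i = K (Suc j)" | "K (Suc j) < i" by linarith
      thus ?thesis
      proof cases
        case 1
        have "n \<le> j"
        proof (rule ccontr)
          assume "\<not> n \<le> j"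
          hence "K (Suc j) \<le> K n" using n(1) by (intro K_mono) auto
          thus False using 1 n by simp
        qed
        thus ?thesis using ge[OF n] low by simp
      next
        case 2
        thus ?thesis using surplus low by simp
      next
        case 3
        have "Suc ?c \<le> U i" using U_less[OF 3 i] by simp
        hence "count_le (U i) ?w = l" using one j by (simp add: count_le_def)
        thus ?thesis using ge[OF n] n(1) by simp
      qed
    qed simp
    hence "?w \<in> A_set u l p"
      using j by (auto simp: A_set_iff[OF p] sorted_append UK_pos)
    hence "?w ! j \<le> ?c" using j by (simp only: eq lower_box_iff[OF v])
    thus False using j by (simp add: nth_append)
  qed
  have "count_le (U (K j)) p + j = K j" if "j \<le> l" for j
  proof (cases j)
    case 0
    thus ?thesis using count_le_0_of_pos[OF p(2)] by (simp add: K_0 U_0)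
  next
    case (Suc j')
    thus ?thesis using le[of j'] ge[of j "K j"] that K_less[of j "Suc j"] by simp
  qed
  thus ?thesis using ge by (auto simp: balanced_def)
qed

section \<open>Multi-shuffles\<close>

lemma size_filter_mset_sum:
  "finite S \<Longrightarrow> size (filter_mset P (\<Sum>j\<in>S. f j)) = (\<Sum>j\<in>S. size (filter_mset P (f j)))"
  by (induction S rule: finite_induct) auto

text \<open>Block \<open>s\<close> consists of the indices strictly between two cuts, so the first \<open>j\<close> blocks cover all
  indices up to \<open>K j\<close> except for the \<open>j\<close> marked ones.\<close>

lemma sum_block_lengths: "j \<le> l \<Longrightarrow> (\<Sum>s\<in>{1..j}. K s - Suc (K (s - 1))) + j = K j"
proof (induction j)
  case (Suc j)
  thus ?case using K_less[of j "Suc j"] by simp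
qed (simp add: K_0)

text \<open>The shifted \<open>\<alpha> j\<close> has all its entries above the marked coordinate \<open>U (K (j - 1))\<close> and, if
  \<open>j \<le> l\<close>, strictly below the next one. So \<open>count_le (U i) p\<close> involves only one word that is counted
  in part, and the parking condition on that word bounds its contribution.\<close>

lemma MS_imp_balanced:
  assumes "p \<in> MS u k"
  shows "balanced p"
proof -
  obtain \<alpha> where \<alpha>: "\<And>j. j \<in> {1..Suc l} \<Longrightarrow> \<alpha> j \<in> PF (block u k j)"
    and p: "mset p = (\<Sum>j\<in>{1..Suc l}. mset (map (\<lambda>x. x + U (K (j - 1))) (\<alpha> j)))"
    using assms unfolding MS_def mem_Collect_eq Suc_eq_plus1 by blast
  define B where "B c j = count_le c (map (\<lambda>x. x + U (K (j - 1))) (\<alpha> j))" for c j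
  have N: "count_le c p = (\<Sum>j\<in>{1..Suc l}. B c j)" for c
    by (simp only: B_def count_le_mset p size_filter_mset_sum finite_atLeastAtMost)
  have len: "length (\<alpha> j) = K j - Suc (K (j - 1))" if "j \<in> {1..Suc l}" for j
    using \<alpha>[OF that] by (simp add: PF_iff_count_le length_block)
  have B_zero: "B c j = 0" if "j \<in> {1..Suc l}" "c \<le> U (K (j - 1))" for c j
    using \<alpha>[OF that(1)] that(2)
    by (force simp: B_def count_le_def filter_empty_conv PF_iff_count_le)
  have B_ge: "i - K (j - 1) \<le> B (U i) j"
    if j: "j \<in> {1..Suc l}" and i: "K (j - 1) \<le> i" "i < K j" for i j
  proof (cases "i = K (j - 1)")
    case False
    let ?n = "i - Suc (K (j - 1))"
    have im: "i \<le> m" using i j K_mono[of j "Suc l"] K_last by auto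
    have n: "?n < length (block u k j)" "Suc (K (j - 1) + ?n) = i"
      using i False by (auto simp: length_block)
    have "?n < count_le (U i - U (K (j - 1))) (\<alpha> j)"
      using \<alpha>[OF j] n nth_block[OF n(1)] by (auto simp: PF_iff_count_le)
    also have "\<dots> = B (U i) j"
      using U_mono[OF i(1) im] by (simp add: B_def count_le_def filter_map o_def le_diff_conv2)
    finally show ?thesis using n by linarith
  qed simp
  have B_full: "B (U i) j = K j - Suc (K (j - 1))"
    if j: "j \<in> {1..l}" and i: "K j \<le> i" "i \<le> m" for i j
  proof (rule antisym)
    show "B (U i) j \<le> K j - Suc (K (j - 1))"
      using count_le_le_length[of "U i" "map (\<lambda>x. x + U (K (j - 1))) (\<alpha> j)"] j len[of j]
      by (simp add: B_def)
    have lt: "K (j - 1) < K j" using K_less[of "j - 1" j] j by auto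
    have "K j - 1 - K (j - 1) \<le> B (U (K j - 1)) j" using B_ge[of j "K j - 1"] j lt by auto
    also have "\<dots> \<le> B (U i) j"
      unfolding B_def using U_mono[of "K j - 1" i] i by (intro count_le_mono) auto
    finally show "K j - Suc (K (j - 1)) \<le> B (U i) j" by simp
  qed
  \<comment> \<open>At a coordinate in segment \<open>j\<close>, the first \<open>j\<close> words are counted completely, the next one
    in part, and the others not at all.\<close>
  have N_segment: "count_le (U i) p + j = K j + B (U i) (Suc j)"
    if j: "j \<le> l" "K j \<le> i" "i < K (Suc j)" for i j
  proof -
    have im: "i \<le> m" using j K_mono[of "Suc j" "Suc l"] K_last by auto
    have "{1..Suc l} = {1..j} \<union> {Suc j} \<union> {Suc (Suc j)..Suc l}" using j by auto
    hence "count_le (U i) p =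
        sum (B (U i)) {1..j} + B (U i) (Suc j) + sum (B (U i)) {Suc (Suc j)..Suc l}"
      unfolding N by (simp add: sum.union_disjoint)
    moreover have "sum (B (U i)) {Suc (Suc j)..Suc l} = 0"
    proof (intro sum.neutral ballI B_zero)
      fix s assume s: "s \<in> {Suc (Suc j)..Suc l}"
      have "K (Suc j) \<le> K (s - 1)" "K (s - 1) \<le> m" using s by (auto intro!: K_mono K_le)
      thus "U i \<le> U (K (s - 1))" using j by (intro U_mono) auto
    qed auto
    moreover have "sum (B (U i)) {1..j} = (\<Sum>s\<in>{1..j}. K s - Suc (K (s - 1)))"
    proof (rule sum.cong[OF refl])
      fix s assume s: "s \<in> {1..j}"
      have "K s \<le> K j" using s j by (intro K_mono) auto
      thus "B (U i) s = K s - Suc (K (s - 1))" using s j im by (intro B_full) auto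
    qed
    ultimately show ?thesis using sum_block_lengths[OF j(1)] by simp
  qed
  show ?thesis unfolding balanced_def
  proof (intro allI impI conjI)
    fix j assume j: "j \<le> l"
    show "count_le (U (K j)) p + j = K j"
      using N_segment[OF j, of "K j"] K_less[of j "Suc j"] B_zero[of "Suc j" "U (K j)"] j by simp
  next
    fix i j assume j: "j \<le> l" and i: "K j \<le> i \<and> i < K (Suc j)"
    show "i \<le> count_le (U i) p + j"
      using N_segment[OF j, of i] B_ge[of "Suc j" i] i j by simp
  qed
qed

text \<open>Cutting \<open>p\<close> by value at the marked coordinates and shifting the pieces back gives the words
  \<open>\<alpha> j\<close>. The last piece has no upper bound, so that the pieces exhaust \<open>p\<close> for trivial reasons;
  that its entries do not exceed \<open>U m\<close> is then part of the parking condition.\<close>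

lemma balanced_imp_MS:
  assumes p: "l + length p = m" "\<forall>x\<in>set p. 0 < x" and bal: "balanced p"
  shows "p \<in> MS u k"
proof -
  define Q where "Q j x \<longleftrightarrow> U (K (j - 1)) < x \<and> (j \<le> l \<longrightarrow> x \<le> U (K j))" for j x
  define \<alpha> where "\<alpha> j = map (\<lambda>x. x - U (K (j - 1))) (filter (Q j) p)" for j
  have shift: "mset (map (\<lambda>x. x + U (K (j - 1))) (\<alpha> j)) = filter_mset (Q j) (mset p)" for j
  proof -
    have "map (\<lambda>x. x + U (K (j - 1))) (\<alpha> j) = map (\<lambda>x. x) (filter (Q j) p)"
      unfolding \<alpha>_def map_map by (rule map_cong[OF refl]) (auto simp: Q_def)
    thus ?thesis by simp
  qed
  have UK_mono: "U (K i) \<le> U (K j)" if "i \<le> j" "j \<le> l" for i j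
    using that by (intro U_mono K_mono K_le) auto
  have prefix: "(\<Sum>j\<in>{1..n}. filter_mset (Q j) (mset p)) = filter_mset (\<lambda>x. x \<le> U (K n)) (mset p)"
    if "n \<le> l" for n
    using that
  proof (induction n)
    case 0
    have "filter (\<lambda>x. x \<le> 0) p = []" using p(2) by (auto simp: filter_empty_conv)
    thus ?case by (simp add: K_0 U_0 flip: mset_filter)
  next
    case (Suc n)
    thus ?case using UK_mono[of n "Suc n"]
      by (auto simp: Q_def multiset_eq_iff)
  qed
  have total: "(\<Sum>j\<in>{1..Suc l}. filter_mset (Q j) (mset p)) = mset p"
    using prefix[of l] by (auto simp: Q_def multiset_eq_iff)
  have split: "count_le c p = count_le (U (K (j - 1))) p + count_le (c - U (K (j - 1))) (\<alpha> j)"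
    if "U (K (j - 1)) \<le> c" "j \<le> l \<Longrightarrow> c \<le> U (K j)" for c j
  proof -
    have "count_le (c - U (K (j - 1))) (\<alpha> j) =
        length (filter (\<lambda>x. U (K (j - 1)) < x \<and> x \<le> c) p)"
      unfolding count_le_def \<alpha>_def filter_map length_map filter_filter o_def
      using that by (intro arg_cong[where f = length] filter_cong) (auto simp: Q_def)
    moreover have "length (filter (\<lambda>x. x \<le> c) xs) =
        length (filter (\<lambda>x. x \<le> b) xs) + length (filter (\<lambda>x. b < x \<and> x \<le> c) xs)"
      if "b \<le> c" for b xs
      using that by (induction xs) auto
    ultimately show ?thesis using that(1) by (simp add: count_le_def)
  qed
  have "\<alpha> j \<in> PF (block u k j)" if j: "j \<in> {1..Suc l}" for j
  proof -
    have lt: "K (j - 1) < K j" using K_less[of "j - 1" j] j by auto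
    have prev: "count_le (U (K (j - 1))) p + (j - 1) = K (j - 1)"
      using balancedD_eq[OF bal, of "j - 1"] j by auto
    have len: "length (\<alpha> j) = K j - Suc (K (j - 1))"
    proof (cases "j \<le> l")
      case True
      have "count_le (U (K j) - U (K (j - 1))) (\<alpha> j) = length (\<alpha> j)"
        by (rule count_le_eq_length) (use True in \<open>auto simp: \<alpha>_def Q_def\<close>)
      hence "count_le (U (K j)) p = count_le (U (K (j - 1))) p + length (\<alpha> j)"
        using split[of j "U (K j)"] UK_mono[of "j - 1" j] True by simp
      thus ?thesis using balancedD_eq[OF bal True] prev j unfolding atLeastAtMost_iff by linarith
    next
      case False
      hence jl: "j = Suc l" using j by simp
      have "length p = length (filter (\<lambda>x. x \<le> U (K l)) p) + length (filter (Q j) p)"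
        using sum_length_filter_compl[of "\<lambda>x. x \<le> U (K l)" p] by (simp add: jl Q_def[abs_def] not_le)
      thus ?thesis using prev p(1) K_le[of l] by (simp add: jl K_last \<alpha>_def count_le_def)
    qed
    have cnt: "i < count_le (block u k j ! i) (\<alpha> j)" if i: "i < length (block u k j)" for i
    proof -
      let ?i = "Suc (K (j - 1) + i)"
      have lt: "K (j - 1) \<le> ?i" "?i < K j" using i by (auto simp: length_block)
      have im: "?i \<le> m" using lt j K_mono[of j "Suc l"] K_last by auto
      have "?i \<le> count_le (U ?i) p + (j - 1)"
        using balancedD_ge[OF bal, of "j - 1" ?i] lt j by auto
      also have "count_le (U ?i) p =
          count_le (U (K (j - 1))) p + count_le (U ?i - U (K (j - 1))) (\<alpha> j)"
        using lt by (intro split U_mono im K_le) auto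
      finally show ?thesis using prev by (simp add: nth_block[OF i])
    qed
    show ?thesis using len cnt
      by (auto simp: PF_iff_count_le length_block \<alpha>_def Q_def)
  qed
  thus ?thesis
    unfolding MS_def mem_Collect_eq Suc_eq_plus1[symmetric]
    by (intro exI[of _ \<alpha>]) (simp only: shift total, blast)
qed

end

section \<open>The equivalence\<close>

theorem theorem2p5:
  fixes m l :: nat and u v k p :: "nat list"
  assumes "1 \<le> m"
    and "length u = m" and "\<forall>x\<in>set u. 0 < x" and "sorted_wrt (<) u"
    and "1 \<le> l" and "l \<le> m"
    and "length k = l" and "set k \<subseteq> {1..m}" and "sorted_wrt (<) k"
    and "length v = l" and "\<forall>i\<in>{1..l}. coord v i = coord u (coord k i)"
    and "length p = m - l" and "\<forall>x\<in>set p. 0 < x"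
  shows "A_set u l p = lower_box v \<longleftrightarrow> p \<in> MS u k"
proof -
  interpret marked_vector u k
    using assms by unfold_locales auto
  have p: "length k + length p = length u" using assms by simp
  have v: "length v = length k" using assms by simp
  have v': "v ! j = coord u (cut u k (Suc j))" if "j < length k" for j
    using assms(11)[rule_format, of "Suc j"] that assms(7) by (simp add: coord_def cut_def)
  have "A_set u (length k) p = lower_box v \<longleftrightarrow> balanced p"
    using balanced_imp_A_set_eq[OF p assms(13) v v'] A_set_eq_imp_balanced[OF p assms(13) v v']
    by blast
  also have "\<dots> \<longleftrightarrow> p \<in> MS u k"
    using MS_imp_balanced balanced_imp_MS[OF p assms(13)] by blast
  finally show ?thesis by (simp only: assms(7))
qed

end
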